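(* Let $n,p\in\{1,2,3,\ldots\}$, let $A,B\in\mathbb{R}^{p\times n}$ with $\operatorname{rank}(A\ B)=p$, and let $G:\mathbb{R}^n\rightrightarrows\mathbb{R}^n$ be the linear relation with $\operatorname{gra} G=\{(x,x^* )\in\mathbb{R}^n\times\mathbb{R}^n\mid Ax+Bx^*=0\}$. Reduce $(A\ B)$ to row echelon form by Gaussian elimination and solve for the basic variables in terms of the free variables $y_1,\ldots,y_{2n-p}$, so that the solutions of $Ax+Bx^*=0$ are $\begin{pmatrix} x\\ x^*\end{pmatrix}=h_1y_1+\cdots+h_{2n-p}y_{2n-p}$; let $C,D$ be the $n\times(2n-p)$ matrices with $\begin{pmatrix} C \\ D \end{pmatrix}=(h_1,\ldots,h_{2n-p})$, so that $\operatorname{gra}G=\{(Cy,Dy)\mid y\in\mathbb{R}^{2n-p}\}$. Define $E_1,E_2:\mathbb{R}^n\rightrightarrows\mathbb{R}^n$ by $$\operatorname{gra}E_1=\{(Cy,\,Dy+z)\mid y\in\mathbb{R}^{2n-p},\ z\in(\operatorname{ran}C)^{\perp}\},$$ $$\operatorname{gra}E_2=\{(Cy+z,\,Dy)\mid y\in\mathbb{R}^{2n-p},\ z\in(\operatorname{ran}D)^{\perp}\}.$$ Then: (i) $E_1$ is a maximally monotone extension of $G$ with $\operatorname{dom}E_1=\operatorname{dom}G$. Moreover, $$\operatorname{gra}E_1=\operatorname{ran}\begin{pmatrix} C \\ D \end{pmatrix}+\big(\{0\}\times(\operatorname{ran}C)^{\perp}\big)=\operatorname{ran}\begin{pmatrix}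 C \\ D \end{pmatrix}+\big(\{0\}\times\ker C^{\intercal}\big).$$ (ii) $E_2$ is a maximally monotone extension of $G$ with $\operatorname{ran}E_2=\operatorname{ran}G$. Moreover, $$\operatorname{gra}E_2=\operatorname{ran}\begin{pmatrix} C \\ D \end{pmatrix}+\big((\operatorname{ran}D)^{\perp}\times\{0\}\big)=\operatorname{ran}\begin{pmatrix} C \\ D \end{pmatrix}+\big(\ker D^{\intercal}\times\{0\}\big).$$
   Context: $\mathbb{R}^n$ carries the Euclidean inner product $\langle\cdot,\cdot\rangle$. For a set-valued operator $T:\mathbb{R}^n\rightrightarrows\mathbb{R}^n$, the graph is $\operatorname{gra}T=\{(x,x^* )\mid x^*\in Tx\}$; $T$ is a linear relation if $\operatorname{gra}T$ is a linear subspace. $\operatorname{dom}T=\{x\mid Tx\ne\varnothing\}$ and $\operatorname{ran}T=\bigcup_xTx$. $T$ is monotone if $\langle x-y,x^*-y^*\rangle\ge0$ for all $(x,x^* ),(y,y^* )\in\operatorname{gra}T$, and maximally monotone if it is monotone and has no proper monotone extension (in the sense of graph inclusion). $S$ is an extension of $T$ if $\operatorname{gra}T\subseteq\operatorname{gra}S$. For a matrix $M$, $\operatorname{ran}M$ is its column space and $\ker M$ its null space; $S^{\perp}$ is the orthogonal complement of $S$. Pairs in $\mathbb{R}^n\times\mathbb{R}^n$ are identified with column vectors in $\mathbb{R}^{2n}$; $\dim\operatorname{gra}G=2n-p$.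
   Formalization: The relation G is additionally assumed to be monotone; without this the claim fails (n = p = 1, A = B = (1) gives G = -Id, which has no monotone extension), and the conclusion itself forces G to be monotone. *)

theory Defs
  imports
    Complex_Main
    "Jordan_Normal_Form.DL_Rank"
    "Jordan_Normal_Form.Matrix_Kernel"
    "HOL-Library.Set_Algebras"
    "HOL-Library.Product_Plus"
    "HOL-Library.Multiset"
begin

text \<open>
  \<open>\<real>\<^sup>n\<close> is \<open>carrier_vec n\<close>, so an operator on \<open>\<real>\<^sup>n\<close> is a function on \<open>real vec\<close>
  (vectors of all dimensions) whose graph lies in \<open>carrier_vec n \<times> carrier_vec n\<close>; in particular it is empty-valued
  at vectors of any other dimension.
\<close>

type_synonym set_operator = "real vec \<Rightarrow> real vec set"

definition gra :: "set_operator \<Rightarrow> (real vec \<times> real vec) set" where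
  "gra T = {(x, xs). xs \<in> T x}"

definition operator_on :: "nat \<Rightarrow> set_operator \<Rightarrow> bool" where
  "operator_on n T \<longleftrightarrow> gra T \<subseteq> carrier_vec n \<times> carrier_vec n"

definition op_dom :: "set_operator \<Rightarrow> real vec set" where
  "op_dom T = {x. T x \<noteq> {}}"

definition op_ran :: "set_operator \<Rightarrow> real vec set" where
  "op_ran T = (\<Union>x. T x)"

definition is_extension :: "set_operator \<Rightarrow> set_operator \<Rightarrow> bool" where
  "is_extension S T \<longleftrightarrow> gra T \<subseteq> gra S"

definition monotone_operator :: "set_operator \<Rightarrow> bool" where
  "monotone_operator T \<longleftrightarrow>
     (\<forall>(x, xs) \<in> gra T. \<forall>(y, ys) \<in> gra T. (x - y) \<bullet> (xs - ys) \<ge> 0)"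

definition maximally_monotone :: "nat \<Rightarrow> set_operator \<Rightarrow> bool" where
  "maximally_monotone n T \<longleftrightarrow>
     operator_on n T \<and> monotone_operator T \<and>
     (\<forall>S. operator_on n S \<and> monotone_operator S \<and> is_extension S T \<longrightarrow> gra S = gra T)"

definition append_cols :: "real mat \<Rightarrow> real mat \<Rightarrow> real mat" where
  "append_cols A B = four_block_mat A B (0\<^sub>m 0 (dim_col A)) (0\<^sub>m 0 (dim_col B))"

text \<open>
  The identification of column vectors of length \<open>2n\<close> with pairs in \<open>\<real>\<^sup>n \<times> \<real>\<^sup>n\<close>:
  upper and lower half.
\<close>

definition as_pair :: "nat \<Rightarrow> real vec \<Rightarrow> real vec \<times> real vec" where
  "as_pair n v = (vec_first v n, vec_last v n)"

text \<open>
  \<open>gauss_jordan_single M\<close> is the reduced row echelon form of \<open>M\<close>. For each non-pivot column \<open>j\<close> of it,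
  \<open>find_base_vectors\<close> returns the solution of \<open>M v = 0\<close> whose free variable \<open>j\<close> is 1 and whose other
  free variables are 0, i.e. the coefficient vector of that free variable in the general solution.
\<close>

definition free_variable_solutions :: "real mat \<Rightarrow> real vec list" where
  "free_variable_solutions M = find_base_vectors (gauss_jordan_single M)"

end

theory Submission
  imports Defs
begin

text \<open>Gaussian elimination parametrises the kernel of (A B), so gra G consists of the pairs
  (Cy, Dy). Testing the monotonicity of G against the origin gives <Cy, Dy> >= 0 for every y, and by
  linearity this controls all pairs of points.

  Adding (ran C)^perp to the values changes no first component, so the domain is kept. The added
  vectors are orthogonal to all differences of first components, so \<open>E\<^sub>1\<close> stays
  monotone. The points (Cy, Dy + t r) all lie in the graph, so <r, x* - Dy> - t |r|^2 >= 0 for all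
  real t, which forces r = 0. Comparing next with the points over C(y + t w) gives an expression in
  t, nonnegative everywhere and without constant term; its linear coefficient -<x* - Dy, Cw> must
  vanish (\<open>linear_term_zero\<close>). Hence x* - Dy is orthogonal to ran C and the pair was
  already in the graph.

  The inverse of \<open>E\<^sub>2\<close> is the same construction with C and D exchanged, and
  inversion preserves maximal monotonicity (\<open>maximally_monotone_inverse\<close>). The kernel
  forms of the graphs rest on (ran C)^perp = ker C^T
  (\<open>orthogonal_complement_col_space\<close>).\<close>

lemma op_dom_eq: "op_dom T = fst ` gra T"
  by (auto simp: op_dom_def gra_def image_iff)

lemma op_ran_eq: "op_ran T = snd ` gra T"
  by (auto simp: op_ran_def gra_def image_iff)

section \<open>Inverse operators: exchanging the two components of a graph\<close>

definition inverse_operator :: "set_operator \<Rightarrow> set_operator" where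
  "inverse_operator T = (\<lambda>xs. {x. xs \<in> T x})"

lemma gra_inverse_operator: "gra (inverse_operator T) = prod.swap ` gra T"
  by (auto simp: gra_def inverse_operator_def image_iff)

lemma monotone_operatorD:
  "monotone_operator T \<Longrightarrow> (x, xs) \<in> gra T \<Longrightarrow> (y, ys) \<in> gra T \<Longrightarrow> (x - y) \<bullet> (xs - ys) \<ge> 0"
  unfolding monotone_operator_def by fastforce

lemma operator_on_inverse: "operator_on n T \<Longrightarrow> operator_on n (inverse_operator T)"
  by (auto simp: operator_on_def gra_inverse_operator)

lemma monotone_inverse_operator:
  assumes "operator_on n T" and "monotone_operator T"
  shows "monotone_operator (inverse_operator T)"
proof -
  have "(xs - ys) \<bullet> (x - y) \<ge> 0" if "(x, xs) \<in> gra T" "(y, ys) \<in> gra T" for x xs y ys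
  proof -
    have c: "x \<in> carrier_vec n" "xs \<in> carrier_vec n" "y \<in> carrier_vec n" "ys \<in> carrier_vec n"
      using that assms(1) by (auto simp: operator_on_def)
    have "(xs - ys) \<bullet> (x - y) = (x - y) \<bullet> (xs - ys)"
      using c by (intro comm_scalar_prod[of _ n]) auto
    then show ?thesis using monotone_operatorD[OF assms(2) that] by simp
  qed
  then show ?thesis
    unfolding monotone_operator_def gra_inverse_operator by auto
qed

text \<open>Swapping components is an involution that respects inclusion of graphs, and monotonicity
  is symmetric in the two components. An extension of the inverse of T therefore swaps back to an
  extension of T. This transfers the result for \<open>E\<^sub>1\<close> to
  \<open>E\<^sub>2\<close>.\<close>

lemma maximally_monotone_inverse:
  assumes "maximally_monotone n T"
  shows "maximally_monotone n (inverse_operator T)"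
proof -
  have T: "operator_on n T" "monotone_operator T"
    and max: "\<And>S. operator_on n S \<Longrightarrow> monotone_operator S \<Longrightarrow> is_extension S T \<Longrightarrow> gra S = gra T"
    using assms by (auto simp: maximally_monotone_def)
  have swap_gra: "prod.swap ` gra (inverse_operator R) = gra R" for R
    by (simp add: gra_inverse_operator image_image)
  have "gra S = gra (inverse_operator T)"
    if S: "operator_on n S" "monotone_operator S" and ext: "is_extension S (inverse_operator T)" for S
  proof -
    have "gra T \<subseteq> gra (inverse_operator S)"
      using image_mono[OF ext[unfolded is_extension_def], of prod.swap]
      unfolding swap_gra gra_inverse_operator[of S] .
    then have "gra (inverse_operator S) = gra T"
      using max[OF operator_on_inverse[OF S(1)] monotone_inverse_operator[OF S]]
      by (simp add: is_extension_def)
    then have "prod.swap ` gra (inverse_operator S) = prod.swap ` gra T" by simp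
    then show ?thesis unfolding swap_gra gra_inverse_operator[of T] .
  qed
  then show ?thesis
    unfolding maximally_monotone_def
    using operator_on_inverse[OF T(1)] monotone_inverse_operator[OF T] by blast
qed

section \<open>Orthogonal projection onto a span, and the complement of a column space\<close>

lemma minus_add_eq_minus_minus_vec:
  fixes a b c :: "'a :: ab_group_add vec"
  assumes "a \<in> carrier_vec n" "b \<in> carrier_vec n" "c \<in> carrier_vec n"
  shows "a - (b + c) = (a - b) - c"
  using assms by (intro eq_vecI) auto

text \<open>Gram-Schmidt, by induction on the list of generators. With x left arbitrary, the
  induction hypothesis projects both x and the new generator v onto the span of the old
  ones.\<close>

lemma orthogonal_projection_span:
  fixes x :: "real vec"
  assumes "x \<in> carrier_vec n" and "set vs \<subseteq> carrier_vec n"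
  shows "\<exists>w \<in> LinearCombinations.module.span class_ring (module_vec TYPE(real) n) (set vs).
    \<forall>v \<in> set vs. (x - w) \<bullet> v = 0"
  using assms
proof (induction vs arbitrary: x)
  case Nil
  interpret vec_space "TYPE(real)" n .
  show ?case using span_empty by auto
next
  case (Cons v vs)
  interpret vec_space "TYPE(real)" n .
  have v: "v \<in> carrier_vec n" and vs: "set vs \<subseteq> carrier_vec n" and x: "x \<in> carrier_vec n"
    using Cons.prems by auto
  obtain w where w: "w \<in> span (set vs)" and wo: "\<And>u. u \<in> set vs \<Longrightarrow> (x - w) \<bullet> u = 0"
    using Cons.IH[OF x vs] by auto
  obtain v2 where v2: "v2 \<in> span (set vs)" and vo: "\<And>u. u \<in> set vs \<Longrightarrow> (v - v2) \<bullet> u = 0"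
    using Cons.IH[OF v vs] by auto
  have wc: "w \<in> carrier_vec n" and v2c: "v2 \<in> carrier_vec n"
    using w v2 vs span_closed by auto
  \<comment> \<open>\<open>v1\<close> is the part of v orthogonal to the old generators, and
    \<open>c\<close> the coefficient of the projection of x - w onto it. If v already lies in the
    old span, then \<open>v1\<close> is zero, and the default value 0 of the division is
    harmless.\<close>
  define v1 where "v1 = v - v2"
  define c where "c = ((x - w) \<bullet> v1) / (v1 \<bullet> v1)"
  define w' where "w' = w + c \<cdot>\<^sub>v v1"
  have v1c: "v1 \<in> carrier_vec n" using v v2c by (simp add: v1_def)
  \<comment> \<open>Orthogonality to the generators extends to their span; this later handles the
    component \<open>v2\<close> of v.\<close>
  have perp: "u \<bullet> s = 0" if "u \<in> carrier_vec n" "\<And>r. r \<in> set vs \<Longrightarrow> u \<bullet> r = 0" "s \<in> span (set vs)" for u s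
  proof -
    have "u \<in> orthogonal_complement (span (set vs))"
      unfolding in_orthogonal_complement_span[OF vs] using that by (auto simp: orthogonal_complement_def)
    then show ?thesis using that(3) by (auto simp: orthogonal_complement_def)
  qed
  have mono: "span (set vs) \<subseteq> span (set (v # vs))"
    by (rule span_is_monotone) auto
  have vvs: "set (v # vs) \<subseteq> carrier_vec n" using v vs by auto
  have vin: "v \<in> span (set (v # vs))" using span_mem[OF vvs] by auto
  have v1in: "v1 \<in> span (set (v # vs))"
  proof -
    have "v1 = v + (-1) \<cdot>\<^sub>v v2" unfolding v1_def using v v2c by (intro eq_vecI) auto
    moreover have "(-1) \<cdot>\<^sub>v v2 \<in> span (set (v # vs))"
      by (rule smult_in_span[OF vvs]) (use mono v2 in blast)
    ultimately show ?thesis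
      using span_add1[OF vvs vin] by simp
  qed
  have w'in: "w' \<in> span (set (v # vs))"
    unfolding w'_def using mono w by (intro span_add1[OF vvs _ smult_in_span[OF vvs v1in]]) auto
  have exp: "(x - w') \<bullet> u = (x - w) \<bullet> u - c * (v1 \<bullet> u)" if u: "u \<in> carrier_vec n" for u
  proof -
    have "x - w' = (x - w) - c \<cdot>\<^sub>v v1"
      unfolding w'_def by (rule minus_add_eq_minus_minus_vec) (use x wc v1c in auto)
    then show ?thesis
      using x wc v1c u by (simp add: minus_scalar_prod_distrib[of _ n])
  qed
  have o1: "(x - w') \<bullet> u = 0" if "u \<in> set vs" for u
    using exp[of u] wo[OF that] vo[OF that] vs that by (auto simp: v1_def)
  have "(x - w') \<bullet> v1 = 0"
  proof (cases "v1 \<bullet> v1 = 0")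
    case True
    then have "v1 = 0\<^sub>v n"
      using conjugate_square_eq_0_vec[OF v1c] by simp
    then show ?thesis using x w'_def wc v1c by auto
  next
    case False
    then show ?thesis using exp[OF v1c] by (simp add: c_def)
  qed
  moreover have "(x - w') \<bullet> v2 = 0"
    using perp[OF _ o1 v2] x wc v1c by (auto simp: w'_def)
  moreover have "v = v1 + v2"
    unfolding v1_def using v v2c by (intro eq_vecI) auto
  ultimately have "(x - w') \<bullet> v = 0"
    using scalar_prod_add_distrib[of "x - w'" n v1 v2] x wc v1c v2c by (auto simp: w'_def)
  then show ?case using o1 w'in by auto
qed

lemma col_space_eq_image:
  fixes C :: "'a :: field mat"
  assumes "C \<in> carrier_mat n m"
  shows "vec_space.col_space n C = (*\<^sub>v) C ` carrier_vec m"
  using assms vec_space.col_space_eq[OF assms] by auto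

text \<open>The entries of C^T z are the inner products of z with the columns of C, and
  orthogonality to the columns is the same as orthogonality to their span.\<close>

lemma orthogonal_complement_col_space:
  fixes C :: "'a :: field mat"
  assumes C: "C \<in> carrier_mat n m"
  shows "vec_module.orthogonal_complement n (vec_space.col_space n C) = mat_kernel C\<^sup>T"
proof -
  interpret vec_space "TYPE('a)" n .
  have sub: "set (cols C) \<subseteq> carrier_vec n"
    using cols_dim[of C] C by auto
  have "z \<in> orthogonal_complement (set (cols C)) \<longleftrightarrow> z \<in> mat_kernel C\<^sup>T" for z
  proof (cases "z \<in> carrier_vec n")
    case True
    have "(\<forall>y \<in> set (cols C). z \<bullet> y = 0) \<longleftrightarrow> (\<forall>j < m. col C j \<bullet> z = 0)"
      using C True by (auto simp: cols_def comm_scalar_prod[of z n])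
    also have "\<dots> \<longleftrightarrow> C\<^sup>T *\<^sub>v z = 0\<^sub>v m"
      using C by (auto simp: vec_eq_iff)
    finally show ?thesis
      using C True by (simp add: orthogonal_complement_def mat_kernel[of "C\<^sup>T" m n])
  next
    case False
    then show ?thesis
      using C by (simp add: orthogonal_complement_def mat_kernel[of "C\<^sup>T" m n])
  qed
  then show ?thesis
    unfolding col_space_def in_orthogonal_complement_span[OF sub] by auto
qed

lemma mem_orthogonal_col_space_iff:
  fixes C :: "'a :: field mat"
  assumes "C \<in> carrier_mat n m"
  shows "z \<in> vec_module.orthogonal_complement n (vec_space.col_space n C) \<longleftrightarrow>
    z \<in> carrier_vec n \<and> (\<forall>y \<in> carrier_vec m. z \<bullet> (C *\<^sub>v y) = 0)"
  unfolding col_space_eq_image[OF assms] vec_module.orthogonal_complement_def by auto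

lemma orthogonal_decomposition_col_space:
  fixes C :: "real mat"
  assumes C: "C \<in> carrier_mat n m" and x: "x \<in> carrier_vec n"
  obtains y where "y \<in> carrier_vec m"
    and "x - C *\<^sub>v y \<in> vec_module.orthogonal_complement n (vec_space.col_space n C)"
proof -
  interpret vec_space "TYPE(real)" n .
  have sub: "set (cols C) \<subseteq> carrier_vec n"
    using cols_dim[of C] C by auto
  obtain w where w: "w \<in> col_space C" and o: "\<forall>v \<in> set (cols C). (x - w) \<bullet> v = 0"
    using orthogonal_projection_span[OF x sub] unfolding col_space_def by auto
  have "w \<in> carrier_vec n" using w span_closed[OF sub] by (simp add: col_space_def)
  then have "x - w \<in> orthogonal_complement (col_space C)"
    using o x unfolding col_space_def in_orthogonal_complement_span[OF sub]
    by (simp add: orthogonal_complement_def)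
  then show thesis
    using that w unfolding col_space_eq_image[OF C] by auto
qed

section \<open>Maximal monotonicity of the graph enlarged by the complement of ran C\<close>

lemma linear_term_zero:
  fixes a b :: real
  assumes "\<And>t. t * a + t\<^sup>2 * b \<ge> 0"
  shows "a = 0"
proof (rule ccontr)
  assume "a \<noteq> 0"
  \<comment> \<open>Any positive s > b would do: at t = -a/s the expression equals (a/s)^2 (b - s) <
    0.\<close>
  define s where "s = \<bar>b\<bar> + 1"
  have s: "s > 0" "b < s" unfolding s_def by auto
  have "0 \<le> (- a / s) * a + (- a / s)\<^sup>2 * b" by (rule assms)
  also have "\<dots> = (a / s)\<^sup>2 * (b - s)"
    using s by (simp add: field_simps power2_eq_square)
  also have "\<dots> < 0"
    using s \<open>a \<noteq> 0\<close> by (intro mult_pos_neg) auto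
  finally show False by simp
qed

text \<open>
  A pair \<open>(x, xs)\<close> monotonically related to the graph has \<open>x \<in> ran C\<close>, because the second component
  may be shifted along \<open>(ran C)\<^sup>\<bottom>\<close> freely; if \<open>x = C y\<close>, comparing with the points
  over \<open>C (y + t w)\<close> and letting \<open>t \<rightarrow> 0\<close> gives \<open>xs - D y \<bottom> ran C\<close>.
\<close>

lemma maximally_monotone_domain_preserving:
  fixes C D :: "real mat"
  assumes C: "C \<in> carrier_mat n m" and D: "D \<in> carrier_mat n m"
    and pos: "\<And>y. y \<in> carrier_vec m \<Longrightarrow> (C *\<^sub>v y) \<bullet> (D *\<^sub>v y) \<ge> 0"
    and E: "gra E = {(C *\<^sub>v y, D *\<^sub>v y + z) | y z. y \<in> carrier_vec m \<and>
              z \<in> vec_module.orthogonal_complement n (vec_space.col_space n C)}"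
  shows "maximally_monotone n E"
proof -
  let ?K = "vec_module.orthogonal_complement n (vec_space.col_space n C)"
  note K = mem_orthogonal_col_space_iff[OF C]
  have Cc [simp]: "C *\<^sub>v y \<in> carrier_vec n" and Dc [simp]: "D *\<^sub>v y \<in> carrier_vec n" for y
    using C D by (auto intro: mult_mat_vec_carrier carrier_vecI)
  have zero: "0\<^sub>v n \<in> ?K" unfolding K by (auto intro: scalar_prod_left_zero)
  have on: "operator_on n E"
    unfolding operator_on_def E using K by auto
  have "monotone_operator E"
  proof -
    have "(C *\<^sub>v y - C *\<^sub>v y') \<bullet> ((D *\<^sub>v y + z) - (D *\<^sub>v y' + z')) \<ge> 0"
      if y: "y \<in> carrier_vec m" "y' \<in> carrier_vec m" and z: "z \<in> ?K" "z' \<in> ?K" for y y' z z'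
    proof -
      have zc: "z \<in> carrier_vec n" "z' \<in> carrier_vec n" using z K by auto
      have yy: "y - y' \<in> carrier_vec m" using y by simp
      have "(D *\<^sub>v y + z) - (D *\<^sub>v y' + z') = D *\<^sub>v (y - y') + (z - z')"
        unfolding mult_minus_distrib_mat_vec[OF D y] using zc carrier_vecD[OF Dc] 
        by (intro eq_vecI) auto
      moreover have "C *\<^sub>v y - C *\<^sub>v y' = C *\<^sub>v (y - y')"
        unfolding mult_minus_distrib_mat_vec[OF C y] ..
      \<comment> \<open>The shifts are orthogonal to ran C, so only <C(y - y'), D(y - y')> is left,
        which is nonnegative by \<open>pos\<close>.\<close>
      moreover have "(C *\<^sub>v (y - y')) \<bullet> (z - z') = 0"
        using z yy zc unfolding K
        by (simp add: comm_scalar_prod[OF Cc] minus_scalar_prod_distrib[of _ n])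
      ultimately show ?thesis
        using pos[OF yy] zc by (simp add: scalar_prod_add_distrib[of _ n])
    qed
    then show ?thesis unfolding monotone_operator_def E by auto
  qed
  moreover have "gra S = gra E"
    if S: "operator_on n S" "monotone_operator S" and ext: "is_extension S E" for S
  proof
    show "gra E \<subseteq> gra S" using ext by (simp add: is_extension_def)
    have sub: "gra E \<subseteq> gra S" using ext by (simp add: is_extension_def)
    have "(x, xs) \<in> gra E" if mem: "(x, xs) \<in> gra S" for x xs
    proof -
      have x: "x \<in> carrier_vec n" and xs: "xs \<in> carrier_vec n"
        using S(1) mem by (auto simp: operator_on_def)
      have rel: "(x - C *\<^sub>v y) \<bullet> (xs - (D *\<^sub>v y + z)) \<ge> 0"
        if "y \<in> carrier_vec m" "z \<in> ?K" for y z
        by (rule monotone_operatorD[OF S(2) mem]) (use sub that E in auto)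
      obtain y where y: "y \<in> carrier_vec m" and r: "x - C *\<^sub>v y \<in> ?K"
        using orthogonal_decomposition_col_space[OF C x] .
      define r where "r = x - C *\<^sub>v y"
      have rc: "r \<in> carrier_vec n" using x by (simp add: r_def)
      define e where "e = xs - D *\<^sub>v y"
      have ec: "e \<in> carrier_vec n" using xs by (simp add: e_def)
      have "r \<bullet> r = 0"
      proof -
        \<comment> \<open>Since r is orthogonal to ran C, the graph contains the whole line of
          points (Cy, Dy + t r).\<close>
        have "t * - (r \<bullet> r) \<ge> - (r \<bullet> e)" for t
        proof -
          have "t \<cdot>\<^sub>v r \<in> ?K" using r x unfolding K r_def by auto
          then have "0 \<le> r \<bullet> (xs - (D *\<^sub>v y + t \<cdot>\<^sub>v r))"
            using rel[OF y] by (simp add: r_def)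
          also have "xs - (D *\<^sub>v y + t \<cdot>\<^sub>v r) = e - t \<cdot>\<^sub>v r"
            unfolding e_def by (rule minus_add_eq_minus_minus_vec) (use xs rc in auto)
          finally show ?thesis
            using ec rc by (simp add: scalar_prod_minus_distrib[of _ n])
        qed
        \<comment> \<open>For nonzero r this t turns the inequality into -(<r, e> + 1) >= -<r, e>,
          which is absurd.\<close>
        note le = this[of "(r \<bullet> e + 1) / (r \<bullet> r)"]
        show ?thesis
        proof (rule ccontr)
          assume "r \<bullet> r \<noteq> 0"
          then have "(r \<bullet> e + 1) / (r \<bullet> r) * - (r \<bullet> r) = - (r \<bullet> e + 1)" by simp
          with le show False by simp
        qed
      qed
      then have "r = 0\<^sub>v n"
        using conjugate_square_eq_0_vec[OF rc] by simp
      then have xy: "x = C *\<^sub>v y"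
        using x carrier_vecD[OF Cc] unfolding r_def by (auto simp: vec_eq_iff)
      have "e \<bullet> (C *\<^sub>v w) = 0" if w: "w \<in> carrier_vec m" for w
      proof -
        \<comment> \<open>Comparison with the graph point over C(y + t w) with zero shift; the
          differences are -t Cw and e - t Dw.\<close>
        have "t * - (e \<bullet> (C *\<^sub>v w)) + t\<^sup>2 * ((C *\<^sub>v w) \<bullet> (D *\<^sub>v w)) \<ge> 0" for t
        proof -
          have tw: "t \<cdot>\<^sub>v w \<in> carrier_vec m" using w by simp
          have tD: "t \<cdot>\<^sub>v (D *\<^sub>v w) \<in> carrier_vec n" by simp
          have "0 \<le> (x - C *\<^sub>v (y + t \<cdot>\<^sub>v w)) \<bullet> (xs - (D *\<^sub>v (y + t \<cdot>\<^sub>v w) + 0\<^sub>v n))"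
            using rel[OF _ zero] y tw by simp
          also have "x - C *\<^sub>v (y + t \<cdot>\<^sub>v w) = (- t) \<cdot>\<^sub>v (C *\<^sub>v w)"
            unfolding xy mult_add_distrib_mat_vec[OF C y tw] mult_mat_vec[OF C w]
            using carrier_vecD[OF Cc] by (intro eq_vecI) auto
          also have "xs - (D *\<^sub>v (y + t \<cdot>\<^sub>v w) + 0\<^sub>v n) = e - t \<cdot>\<^sub>v (D *\<^sub>v w)"
            unfolding e_def mult_add_distrib_mat_vec[OF D y tw] mult_mat_vec[OF D w]
            using carrier_vecD[OF Dc] xs by (intro eq_vecI) auto
          also have "((- t) \<cdot>\<^sub>v (C *\<^sub>v w)) \<bullet> (e - t \<cdot>\<^sub>v (D *\<^sub>v w)) =
              t * - ((C *\<^sub>v w) \<bullet> e) + t\<^sup>2 * ((C *\<^sub>v w) \<bullet> (D *\<^sub>v w))"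
            unfolding smult_scalar_prod_distrib[OF Cc minus_carrier_vec[OF ec tD]]
              scalar_prod_minus_distrib[OF Cc ec tD]
              scalar_prod_smult_distrib[OF Cc Dc]
            by (simp add: algebra_simps power2_eq_square)
          finally show ?thesis
            by (simp add: comm_scalar_prod[OF ec Cc])
        qed
        from linear_term_zero[OF this] show ?thesis by simp
      qed
      then have "e \<in> ?K" using ec unfolding K by auto
      moreover have "xs = D *\<^sub>v y + e"
        unfolding e_def using xs carrier_vecD[OF Dc] by (intro eq_vecI) auto
      ultimately show ?thesis unfolding E using xy y by auto
    qed
    then show "gra S \<subseteq> gra E" by auto
  qed
  ultimately show ?thesis using on unfolding maximally_monotone_def by blast
qed

section \<open>Gaussian elimination and the parametrisation of the kernel of (A B)\<close>

lemma span_free_variable_solutions: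
  assumes M: "M \<in> carrier_mat nr nc"
  shows "LinearCombinations.module.span class_ring (module_vec TYPE(real) nc)
    (set (free_variable_solutions M)) = mat_kernel M"
    and "set (free_variable_solutions M) \<subseteq> mat_kernel M"
proof -
  let ?R = "gauss_jordan_single M"
  note gj = gauss_jordan_single[OF M refl]
  interpret kernel nr nc ?R by unfold_locales (rule gj(2))
  note fb = find_base_vectors[OF gj(3) gj(2)]
  \<comment> \<open>Row reduction does not change the solution set.\<close>
  have eq: "mat_kernel ?R = mat_kernel M"
    unfolding mat_kernel[OF gj(2)] mat_kernel[OF M] using gj(1) by auto
  \<comment> \<open>The basis property concerns the span taken inside the kernel as a space of its
    own; \<open>span_same\<close> identifies it with the span in the ambient space.\<close>
  show "NC.span (set (free_variable_solutions M)) = mat_kernel M"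
    using fb(3) span_same[OF fb(1)] eq
    unfolding free_variable_solutions_def Ker.basis_def by simp
  show "set (free_variable_solutions M) \<subseteq> mat_kernel M"
    using fb(1) eq by (simp add: free_variable_solutions_def)
qed

lemma append_cols_mult_vec:
  assumes A: "A \<in> carrier_mat p n" and B: "B \<in> carrier_mat p k"
    and "x \<in> carrier_vec n" and "y \<in> carrier_vec k"
  shows "append_cols A B *\<^sub>v (x @\<^sub>v y) = A *\<^sub>v x + B *\<^sub>v y"
proof -
  \<comment> \<open>The lower blocks have no rows, so the second half of the block product is a
    vector of length 0.\<close>
  have "append_cols A B *\<^sub>v (x @\<^sub>v y) = (A *\<^sub>v x + B *\<^sub>v y) @\<^sub>v (0\<^sub>m 0 n *\<^sub>v x + 0\<^sub>m 0 k *\<^sub>v y)"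
    using four_block_mat_mult_vec[OF A B zero_carrier_mat zero_carrier_mat assms(3,4)] A B
    by (simp add: append_cols_def)
  also have "\<dots> = A *\<^sub>v x + B *\<^sub>v y"
    using A B by (intro eq_vecI) auto
  finally show ?thesis .
qed

lemma as_pair_append:
  assumes "x \<in> carrier_vec n" and "y \<in> carrier_vec n"
  shows "as_pair n (x @\<^sub>v y) = (x, y)"
  using assms by (auto simp: as_pair_def vec_first_def vec_last_def)

lemma as_pair_col_space_append_rows:
  assumes C: "C \<in> carrier_mat n m" and D: "D \<in> carrier_mat n m"
  shows "as_pair n ` vec_space.col_space (2 * n) (C @\<^sub>r D) = {(C *\<^sub>v y, D *\<^sub>v y) | y. y \<in> carrier_vec m}"
proof -
  have CD: "C @\<^sub>r D \<in> carrier_mat (2 * n) m"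
    using carrier_append_rows[OF C D] by (simp add: mult_2)
  have "as_pair n ((C @\<^sub>r D) *\<^sub>v y) = (C *\<^sub>v y, D *\<^sub>v y)" if "y \<in> carrier_vec m" for y
    using as_pair_append mat_mult_append[OF C D that] C D that by simp
  then show ?thesis
    unfolding col_space_eq_image[OF CD] by (auto simp: image_image)
qed

lemma as_pair_mat_kernel_append_cols:
  assumes A: "A \<in> carrier_mat p n" and B: "B \<in> carrier_mat p n"
  shows "as_pair n ` mat_kernel (append_cols A B) =
    {(x, xs). x \<in> carrier_vec n \<and> xs \<in> carrier_vec n \<and> A *\<^sub>v x + B *\<^sub>v xs = 0\<^sub>v p}" (is "?L = ?R")
proof -
  have M: "append_cols A B \<in> carrier_mat p (n + n)"
    unfolding append_cols_def carrier_mat_def using A B by auto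
  have "as_pair n v \<in> ?R" if "v \<in> mat_kernel (append_cols A B)" for v
  proof -
    have v: "v \<in> carrier_vec (n + n)" and z: "append_cols A B *\<^sub>v v = 0\<^sub>v p"
      using mat_kernelD[OF M that] .
    have "A *\<^sub>v vec_first v n + B *\<^sub>v vec_last v n = 0\<^sub>v p"
      using append_cols_mult_vec[OF A B, of "vec_first v n" "vec_last v n"] z v by simp
    then show ?thesis by (simp add: as_pair_def)
  qed
  moreover have "(x, xs) \<in> ?L" if "(x, xs) \<in> ?R" for x xs
  proof -
    have "x @\<^sub>v xs \<in> mat_kernel (append_cols A B)"
      using that by (intro mat_kernelI[OF M]) (auto simp: append_cols_mult_vec[OF A B])
    then show ?thesis using as_pair_append[of x n xs] that by (auto simp: image_iff intro!: bexI[of _ "x @\<^sub>v xs"])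
  qed
  ultimately show ?thesis by (intro equalityI image_subsetI subrelI)
qed

section \<open>The two extensions of G\<close>

theorem theorem5p2:
  fixes n p :: nat
    and A B C D :: "real mat"
    and hs :: "real vec list"
    and G E\<^sub>1 E\<^sub>2 :: "real vec \<Rightarrow> real vec set"
  assumes "n \<ge> 1" and "p \<ge> 1"
    and "A \<in> carrier_mat p n" and "B \<in> carrier_mat p n"
    and "vec_space.rank p (append_cols A B) = p"
    and "gra G = {(x, xs). x \<in> carrier_vec n \<and> xs \<in> carrier_vec n \<and> A *\<^sub>v x + B *\<^sub>v xs = 0\<^sub>v p}"
    and "monotone_operator G"
    and "mset hs = mset (free_variable_solutions (append_cols A B))"
    and "C \<in> carrier_mat n (2 * n - p)" and "D \<in> carrier_mat n (2 * n - p)"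
    and "C @\<^sub>r D = mat_of_cols (2 * n) hs"
    and "gra E\<^sub>1 = {(C *\<^sub>v y, D *\<^sub>v y + z) | y z.
           y \<in> carrier_vec (2 * n - p) \<and>
           z \<in> vec_module.orthogonal_complement n (vec_space.col_space n C)}"
    and "gra E\<^sub>2 = {(C *\<^sub>v y + z, D *\<^sub>v y) | y z.
           y \<in> carrier_vec (2 * n - p) \<and>
           z \<in> vec_module.orthogonal_complement n (vec_space.col_space n D)}"
  shows "(maximally_monotone n E\<^sub>1 \<and> is_extension E\<^sub>1 G \<and> op_dom E\<^sub>1 = op_dom G \<and>
          gra E\<^sub>1 = as_pair n ` vec_space.col_space (2 * n) (C @\<^sub>r D)
                   + {0\<^sub>v n} \<times> vec_module.orthogonal_complement n (vec_space.col_space n C) \<and>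
          gra E\<^sub>1 = as_pair n ` vec_space.col_space (2 * n) (C @\<^sub>r D)
                   + {0\<^sub>v n} \<times> mat_kernel C\<^sup>T) \<and>
         (maximally_monotone n E\<^sub>2 \<and> is_extension E\<^sub>2 G \<and> op_ran E\<^sub>2 = op_ran G \<and>
          gra E\<^sub>2 = as_pair n ` vec_space.col_space (2 * n) (C @\<^sub>r D)
                   + vec_module.orthogonal_complement n (vec_space.col_space n D) \<times> {0\<^sub>v n} \<and>
          gra E\<^sub>2 = as_pair n ` vec_space.col_space (2 * n) (C @\<^sub>r D)
                   + mat_kernel D\<^sup>T \<times> {0\<^sub>v n})"
proof -
  define m where "m = 2 * n - p"
  let ?KC = "vec_module.orthogonal_complement n (vec_space.col_space n C)"
  let ?KD = "vec_module.orthogonal_complement n (vec_space.col_space n D)"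
  note A = assms(3) and B = assms(4)
  have C: "C \<in> carrier_mat n m" and D: "D \<in> carrier_mat n m"
    using assms(9,10) by (auto simp: m_def)
  have M: "append_cols A B \<in> carrier_mat p (2 * n)"
    unfolding append_cols_def carrier_mat_def using A B by auto
  \<comment> \<open>A column space depends only on the set of columns, so the order in which the
    free variables are numbered is immaterial.\<close>
  have hs: "set hs = set (free_variable_solutions (append_cols A B))"
    using assms(8) by (rule mset_eq_setD)
  have "set hs \<subseteq> carrier_vec (2 * n)"
    using span_free_variable_solutions(2)[OF M] mat_kernel_carrier[OF M] hs by auto
  then have col: "vec_space.col_space (2 * n) (C @\<^sub>r D) = mat_kernel (append_cols A B)"
    unfolding assms(11) vec_space.col_space_def
    using span_free_variable_solutions(1)[OF M] hs by simp
  have P: "as_pair n ` vec_space.col_space (2 * n) (C @\<^sub>r D) = {(C *\<^sub>v y, D *\<^sub>v y) | y. y \<in> carrier_vec m}"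
    by (rule as_pair_col_space_append_rows[OF C D])
  have G: "gra G = {(C *\<^sub>v y, D *\<^sub>v y) | y. y \<in> carrier_vec m}"
    unfolding assms(6) P[symmetric] col as_pair_mat_kernel_append_cols[OF A B] ..
  have Cc [simp]: "C *\<^sub>v y \<in> carrier_vec n" and Dc [simp]: "D *\<^sub>v y \<in> carrier_vec n" for y
    using C D by (auto intro: carrier_vecI)
  \<comment> \<open>Monotonicity of G is applied to the points with parameters y and 0, the second
    being the origin.\<close>
  have posCD: "(C *\<^sub>v y) \<bullet> (D *\<^sub>v y) \<ge> 0" if y: "y \<in> carrier_vec m" for y
  proof -
    have "(C *\<^sub>v y, D *\<^sub>v y) \<in> gra G" and "(C *\<^sub>v 0\<^sub>v m, D *\<^sub>v 0\<^sub>v m) \<in> gra G"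
      unfolding G using y by auto
    from monotone_operatorD[OF assms(7) this]
    have "0 \<le> (C *\<^sub>v (y - 0\<^sub>v m)) \<bullet> (D *\<^sub>v (y - 0\<^sub>v m))"
      unfolding mult_minus_distrib_mat_vec[OF C y zero_carrier_vec]
        mult_minus_distrib_mat_vec[OF D y zero_carrier_vec] .
    also have "y - 0\<^sub>v m = y" using y by auto
    finally show ?thesis .
  qed
  have posDC: "(D *\<^sub>v y) \<bullet> (C *\<^sub>v y) \<ge> 0" if "y \<in> carrier_vec m" for y
    unfolding comm_scalar_prod[OF Dc Cc] by (rule posCD[OF that])
  have E1: "gra E\<^sub>1 = {(C *\<^sub>v y, D *\<^sub>v y + z) | y z. y \<in> carrier_vec m \<and> z \<in> ?KC}"
    and E2: "gra E\<^sub>2 = {(C *\<^sub>v y + z, D *\<^sub>v y) | y z. y \<in> carrier_vec m \<and> z \<in> ?KD}"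
    using assms(12,13) by (auto simp: m_def)
  have zero: "0\<^sub>v n \<in> ?KC" "0\<^sub>v n \<in> ?KD"
    using mem_orthogonal_col_space_iff[OF C] mem_orthogonal_col_space_iff[OF D]
    by (auto intro: scalar_prod_left_zero)

  have GE1: "(C *\<^sub>v y, D *\<^sub>v y) \<in> gra E\<^sub>1" and GE2: "(C *\<^sub>v y, D *\<^sub>v y) \<in> gra E\<^sub>2"
    if "y \<in> carrier_vec m" for y
  proof -
    have "(C *\<^sub>v y, D *\<^sub>v y + 0\<^sub>v n) \<in> gra E\<^sub>1" and "(C *\<^sub>v y + 0\<^sub>v n, D *\<^sub>v y) \<in> gra E\<^sub>2"
      unfolding E1 E2 using zero that by blast+
    then show "(C *\<^sub>v y, D *\<^sub>v y) \<in> gra E\<^sub>1" "(C *\<^sub>v y, D *\<^sub>v y) \<in> gra E\<^sub>2" by simp_all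
  qed
  have ext1: "gra G \<subseteq> gra E\<^sub>1" and ext2: "gra G \<subseteq> gra E\<^sub>2"
    unfolding G using GE1 GE2 by blast+
  \<comment> \<open>The shift enters only the second component for \<open>E\<^sub>1\<close> and only
    the first for \<open>E\<^sub>2\<close>.\<close>
  have "fst ` gra E\<^sub>1 \<subseteq> fst ` gra G" and "snd ` gra E\<^sub>2 \<subseteq> snd ` gra G"
    unfolding E1 E2 G by (auto simp: image_iff)
  then have dom1: "op_dom E\<^sub>1 = op_dom G" and ran2: "op_ran E\<^sub>2 = op_ran G"
    unfolding op_dom_eq op_ran_eq using image_mono[OF ext1, of fst] image_mono[OF ext2, of snd]
    by (metis subset_antisym)+
  have sum1: "gra E\<^sub>1 = as_pair n ` vec_space.col_space (2 * n) (C @\<^sub>r D) + {0\<^sub>v n} \<times> ?KC"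
    unfolding P
  proof (intro equalityI subsetI)
    fix q assume "q \<in> gra E\<^sub>1"
    then obtain y z where "y \<in> carrier_vec m" "z \<in> ?KC" and q: "q = (C *\<^sub>v y, D *\<^sub>v y + z)"
      unfolding E1 by blast
    then have "(C *\<^sub>v y, D *\<^sub>v y) + (0\<^sub>v n, z) \<in> {(C *\<^sub>v y, D *\<^sub>v y) | y. y \<in> carrier_vec m} + {0\<^sub>v n} \<times> ?KC"
      by (intro set_plus_intro) auto
    then show "q \<in> {(C *\<^sub>v y, D *\<^sub>v y) | y. y \<in> carrier_vec m} + {0\<^sub>v n} \<times> ?KC"
      by (simp add: q)
  next
    fix q assume "q \<in> {(C *\<^sub>v y, D *\<^sub>v y) | y. y \<in> carrier_vec m} + {0\<^sub>v n} \<times> ?KC"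
    then obtain y z where "y \<in> carrier_vec m" "z \<in> ?KC" and "q = (C *\<^sub>v y, D *\<^sub>v y) + (0\<^sub>v n, z)"
      by (elim set_plus_elim) auto
    moreover from this have "q = (C *\<^sub>v y, D *\<^sub>v y + z)" by simp
    ultimately show "q \<in> gra E\<^sub>1" unfolding E1 by blast
  qed
  have sum2: "gra E\<^sub>2 = as_pair n ` vec_space.col_space (2 * n) (C @\<^sub>r D) + ?KD \<times> {0\<^sub>v n}"
    unfolding P
  proof (intro equalityI subsetI)
    fix q assume "q \<in> gra E\<^sub>2"
    then obtain y z where "y \<in> carrier_vec m" "z \<in> ?KD" and q: "q = (C *\<^sub>v y + z, D *\<^sub>v y)"
      unfolding E2 by blast
    then have "(C *\<^sub>v y, D *\<^sub>v y) + (z, 0\<^sub>v n) \<in> {(C *\<^sub>v y, D *\<^sub>v y) | y. y \<in> carrier_vec m} + ?KD \<times> {0\<^sub>v n}"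
      by (intro set_plus_intro) auto
    then show "q \<in> {(C *\<^sub>v y, D *\<^sub>v y) | y. y \<in> carrier_vec m} + ?KD \<times> {0\<^sub>v n}"
      by (simp add: q)
  next
    fix q assume "q \<in> {(C *\<^sub>v y, D *\<^sub>v y) | y. y \<in> carrier_vec m} + ?KD \<times> {0\<^sub>v n}"
    then obtain y z where "y \<in> carrier_vec m" "z \<in> ?KD" and "q = (C *\<^sub>v y, D *\<^sub>v y) + (z, 0\<^sub>v n)"
      by (elim set_plus_elim) auto
    moreover from this have "q = (C *\<^sub>v y + z, D *\<^sub>v y)" by simp
    ultimately show "q \<in> gra E\<^sub>2" unfolding E2 by blast
  qed
  have max1: "maximally_monotone n E\<^sub>1"
    by (rule maximally_monotone_domain_preserving[OF C D posCD E1])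
  \<comment> \<open>Swapped, the graph has the shape required by
    \<open>maximally_monotone_domain_preserving\<close> with C and D exchanged; inverting a second
    time returns \<open>E\<^sub>2\<close>.\<close>
  have "gra (inverse_operator E\<^sub>2) = {(D *\<^sub>v y, C *\<^sub>v y + z) | y z. y \<in> carrier_vec m \<and> z \<in> ?KD}"
    unfolding gra_inverse_operator E2 by force
  from maximally_monotone_inverse[OF maximally_monotone_domain_preserving[OF D C posDC this]]
  have max2: "maximally_monotone n E\<^sub>2" by (simp add: inverse_operator_def)
  show ?thesis
    unfolding is_extension_def orthogonal_complement_col_space[OF C, symmetric]
      orthogonal_complement_col_space[OF D, symmetric]
    by (intro conjI max1 ext1 dom1 sum1 max2 ext2 ran2 sum2)
qed

end
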